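(* Let $G$ be a cograph and let $\lambda\neq 0,-1$ be an eigenvalue of $G$. Then the multiplicity of $\lambda$ as an eigenvalue of $G$ is at most the total number of duplication classes and coduplication classes of $G$.
   Context: A cograph is a finite simple graph that contains no induced subgraph isomorphic to the path on $4$ vertices. Eigenvalues of a graph are those of its adjacency matrix. For a vertex $v$, $N(v)$ is its open neighborhood and $N[v]=N(v)\cup\{v\}$ its closed neighborhood. A duplication class of $G$ is a subset $S\subseteq V(G)$ with $|S|>1$ such that $N(u)=N(v)$ for all $u,v\in S$, and $S$ is maximal with this property; a coduplication class is defined analogously with $N[u]=N[v]$. *)

theory Defs
  imports
    "Graph_Theory.Digraph_Component"
    "Graph_Theory.Digraph_Isomorphism"
    "Jordan_Normal_Form.Char_Poly"
begin

text \<open>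
  A finite simple graph is a digraph satisfying the locale predicate \<open>graph\<close> of the
  Graph Theory entry: finite, loop-free, without parallel arcs, and symmetric, so that an
  undirected edge is a pair of opposite arcs. Induced subgraphs and isomorphism are those
  of the same entry.
\<close>

definition path_graph :: "nat \<Rightarrow> nat pair_pre_digraph" where
  "path_graph n =
     \<lparr> pverts = {..<n}, parcs = {(i, j). i < n \<and> j < n \<and> (j = Suc i \<or> i = Suc j)} \<rparr>"

definition cograph :: "('a, 'b) pre_digraph \<Rightarrow> bool" where
  "cograph G \<longleftrightarrow>
     Digraph.graph G \<and>
     \<not> (\<exists>H. induced_subgraph H G \<and> digraph_iso H (with_proj (path_graph 4)))"

definition open_nbhd :: "('a, 'b) pre_digraph \<Rightarrow> 'a \<Rightarrow> 'a set" where
  "open_nbhd G v = {u \<in> verts G. v \<rightarrow>\<^bsub>G\<^esub> u}"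

definition closed_nbhd :: "('a, 'b) pre_digraph \<Rightarrow> 'a \<Rightarrow> 'a set" where
  "closed_nbhd G v = open_nbhd G v \<union> {v}"

text \<open>
  The parameter \<open>N\<close> is instantiated by the open or the closed neighborhood.
\<close>

definition nbhd_equal_set :: "('a \<Rightarrow> 'a set) \<Rightarrow> ('a, 'b) pre_digraph \<Rightarrow> 'a set \<Rightarrow> bool" where
  "nbhd_equal_set N G S \<longleftrightarrow>
     S \<subseteq> verts G \<and> card S > 1 \<and> (\<forall>u\<in>S. \<forall>v\<in>S. N u = N v)"

definition duplication_class :: "('a, 'b) pre_digraph \<Rightarrow> 'a set \<Rightarrow> bool" where
  "duplication_class G S \<longleftrightarrow>
     nbhd_equal_set (open_nbhd G) G S \<and>
     (\<forall>T. nbhd_equal_set (open_nbhd G) G T \<longrightarrow> S \<subseteq> T \<longrightarrow> T = S)"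

definition coduplication_class :: "('a, 'b) pre_digraph \<Rightarrow> 'a set \<Rightarrow> bool" where
  "coduplication_class G S \<longleftrightarrow>
     nbhd_equal_set (closed_nbhd G) G S \<and>
     (\<forall>T. nbhd_equal_set (closed_nbhd G) G T \<longrightarrow> S \<subseteq> T \<longrightarrow> T = S)"

text \<open>
  The list \<open>vs\<close> is meant to enumerate the vertices without repetition; it fixes the order
  of the rows and columns.
\<close>

definition adjacency_matrix :: "('a, 'b) pre_digraph \<Rightarrow> 'a list \<Rightarrow> real mat" where
  "adjacency_matrix G vs =
     mat (length vs) (length vs) (\<lambda>(i, j). if vs ! i \<rightarrow>\<^bsub>G\<^esub> vs ! j then 1 else 0)"

end

theory Submission
  imports
    Defs
    "Jordan_Normal_Form.Jordan_Normal_Form_Uniqueness"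
    "Jordan_Normal_Form.Jordan_Normal_Form_Existence"
begin

text \<open>
  Call two vertices twins if no third vertex distinguishes them. An eigenvector for an
  eigenvalue other than 0 and -1 takes equal values on twins. An eigenvector of a cograph
  that vanishes on all vertices having a twin is zero: delete one vertex v of a twin pair
  u, v; the eigenvector restricts to the smaller graph, whose twin pairs either were twins
  before or contain u, so the hypothesis persists. Hence the eigenspace injects into the
  values at one representative of each (co)duplication class. The existence of twins follows
  from the fact that a graph without induced path on four vertices is a disjoint union or a
  join, and algebraic and geometric multiplicity agree because the adjacency matrix is symmetric.
\<close>

section \<open>Graphs without an induced path on four vertices split as a disjoint union or a
  join\<close>

definition P4_free :: "('a \<Rightarrow> 'a \<Rightarrow> bool) \<Rightarrow> 'a set \<Rightarrow> bool" where
  "P4_free E W \<longleftrightarrow>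
     \<not> (\<exists>a\<in>W. \<exists>b\<in>W. \<exists>c\<in>W. \<exists>d\<in>W.
          E a b \<and> E b c \<and> E c d \<and> \<not> E a c \<and> \<not> E a d \<and> \<not> E b d)"

lemma P4_freeD:
  assumes "P4_free E W" "a \<in> W" "b \<in> W" "c \<in> W" "d \<in> W" "E a b" "E b c" "E c d"
  shows "E a c \<or> E a d \<or> E b d"
  using assms unfolding P4_free_def by blast

lemma P4_free_subset: "P4_free E W \<Longrightarrow> U \<subseteq> W \<Longrightarrow> P4_free E U"
  unfolding P4_free_def by blast

text \<open>The path on four vertices is self-complementary: the non-edges of a path
  \<open>a b c d\<close> form the path \<open>c a d b\<close>.\<close>

lemma P4_free_complement:
  assumes "symp E" "irreflp E" "P4_free E W"
  shows "P4_free (\<lambda>x y. x \<noteq> y \<and> \<not> E x y) W"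
  unfolding P4_free_def
proof (intro notI, elim bexE conjE)
  fix a b c d
  assume W: "a \<in> W" "b \<in> W" "c \<in> W" "d \<in> W"
    and *: "a \<noteq> b" "\<not> E a b" "b \<noteq> c" "\<not> E b c" "c \<noteq> d" "\<not> E c d"
      "\<not> (a \<noteq> c \<and> \<not> E a c)" "\<not> (a \<noteq> d \<and> \<not> E a d)" "\<not> (b \<noteq> d \<and> \<not> E b d)"
  have "E c a" "E a d" "E d b"
    using * sympD[OF assms(1)] by metis+
  then show False
    using P4_freeD[OF assms(3), of c a d b] W * sympD[OF assms(1)] by blast
qed

text \<open>The first disjunct describes a join, the second a disjoint union. Keeping both in one
  notion makes it invariant under complementation.\<close>

definition homogeneous_split :: "('a \<Rightarrow> 'a \<Rightarrow> bool) \<Rightarrow> 'a set \<Rightarrow> 'a set \<Rightarrow> 'a set \<Rightarrow> bool" where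
  "homogeneous_split E W A B \<longleftrightarrow> A \<noteq> {} \<and> B \<noteq> {} \<and> A \<inter> B = {} \<and> A \<union> B = W \<and>
     ((\<forall>x\<in>A. \<forall>y\<in>B. E x y) \<or> (\<forall>x\<in>A. \<forall>y\<in>B. \<not> E x y))"

lemma homogeneous_split_complement:
  "homogeneous_split (\<lambda>x y. x \<noteq> y \<and> \<not> E x y) W A B \<longleftrightarrow> homogeneous_split E W A B"
proof -
  have "x \<noteq> y" if "A \<inter> B = {}" "x \<in> A" "y \<in> B" for x y
    using that by blast
  then show ?thesis unfolding homogeneous_split_def by auto
qed

text \<open>If \<open>v\<close> is adjacent to everything, split it off. Otherwise it misses some
  vertex, say in \<open>A\<close>. If it has no neighbor in \<open>B\<close>, it can be added to
  \<open>A\<close>; if it has one, its non-neighbors in \<open>A\<close> are cut off from all the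
  rest.\<close>

lemma homogeneous_split_insert:
  assumes sym: "symp E" and P4: "P4_free E (insert v (A \<union> B))"
    and v: "v \<notin> A" "v \<notin> B" and AB: "A \<noteq> {}" "B \<noteq> {}" "A \<inter> B = {}"
    and non: "\<forall>x\<in>A. \<forall>y\<in>B. \<not> E x y"
  shows "\<exists>C D. homogeneous_split E (insert v (A \<union> B)) C D"
proof -
  \<comment> \<open>\<open>A\<close> and \<open>B\<close> are generalized again so that the claim
    also applies with the two sides exchanged.\<close>
  have *: "\<exists>C D. homogeneous_split E (insert v (A \<union> B)) C D"
    if P4': "P4_free E (insert v (A \<union> B))" and v': "v \<notin> A" "v \<notin> B"
      and AB': "A \<noteq> {}" "B \<noteq> {}" "A \<inter> B = {}" and non': "\<forall>x\<in>A. \<forall>y\<in>B. \<not> E x y"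
      and w: "w \<in> A" "\<not> E v w" for A B w
  proof (cases "\<exists>z\<in>B. E v z")
    case False
    then have "homogeneous_split E (insert v (A \<union> B)) (insert v A) B"
      unfolding homogeneous_split_def using v' AB' non' by auto
    then show ?thesis by blast
  next
    case True
    then obtain z where z: "z \<in> B" "E v z" by blast
    let ?C = "{y\<in>A. \<not> E v y}" and ?D = "insert v (B \<union> {y\<in>A. E v y})"
    \<comment> \<open>An edge between \<open>y\<close> and \<open>x\<close> would make
      \<open>y x v z\<close> an induced path, since no edge joins \<open>A\<close> to
      \<open>z\<close>.\<close>
    have "\<not> E y x" if "y \<in> A" "\<not> E v y" "x \<in> A" "E v x" for x y
      using P4_freeD[OF P4', of y x v z] that z non' sympD[OF sym] by blast
    then have "homogeneous_split E (insert v (A \<union> B)) ?C ?D"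
      unfolding homogeneous_split_def using v' AB' non' w sympD[OF sym] by blast
    then show ?thesis by blast
  qed
  consider "\<forall>w\<in>A\<union>B. E v w" | w where "w \<in> A" "\<not> E v w" | w where "w \<in> B" "\<not> E v w"
    by blast
  then show ?thesis
  proof cases
    case 1
    then have "homogeneous_split E (insert v (A \<union> B)) {v} (A \<union> B)"
      unfolding homogeneous_split_def using v AB by auto
    then show ?thesis by blast
  next
    case 2
    show ?thesis by (rule *[OF P4 v AB non 2])
  next
    case 3
    have "\<forall>x\<in>B. \<forall>y\<in>A. \<not> E x y" using non sympD[OF sym] by blast
    with *[of B A w] 3 P4 v AB show ?thesis by (simp add: Un_commute Int_commute)
  qed
qed

text \<open>Induction adding one vertex to a graph that is already split. A join becomes a disjoint
  union in the complement, which has no induced path on four vertices either, so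
  \<open>homogeneous_split_insert\<close> serves both cases.\<close>

lemma P4_free_homogeneous_split:
  assumes "finite W" "2 \<le> card W" "symp E" "irreflp E" "P4_free E W"
  shows "\<exists>A B. homogeneous_split E W A B"
  using assms(1,2,5)
proof (induction W rule: finite_induct)
  case empty
  then show ?case by simp
next
  case (insert v W)
  show ?case
  proof (cases "2 \<le> card W")
    case False
    with insert have "card W = 1" by auto
    then obtain w where "W = {w}" by (auto simp: card_1_singleton_iff)
    with insert.hyps have "homogeneous_split E (insert v W) {v} {w}"
      unfolding homogeneous_split_def by auto
    then show ?thesis by blast
  next
    case True
    with insert.IH P4_free_subset[OF insert.prems(2)] obtain A B
      where AB: "homogeneous_split E W A B" by blast
    let ?E = "\<lambda>x y. x \<noteq> y \<and> \<not> E x y"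
    have W: "W = A \<union> B" and v: "v \<notin> A" "v \<notin> B" and ne: "A \<noteq> {}" "B \<noteq> {}" "A \<inter> B = {}"
      using AB insert.hyps unfolding homogeneous_split_def by auto
    have sym': "symp ?E" using sympD[OF assms(3)] by (auto intro!: sympI)
    consider "\<forall>x\<in>A. \<forall>y\<in>B. \<not> E x y" | "\<forall>x\<in>A. \<forall>y\<in>B. E x y"
      using AB unfolding homogeneous_split_def by blast
    then show ?thesis
    proof cases
      case 1
      from homogeneous_split_insert[OF assms(3) insert.prems(2)[unfolded W] v ne 1]
      show ?thesis unfolding W .
    next
      case 2
      then have "\<forall>x\<in>A. \<forall>y\<in>B. \<not> ?E x y" by simp
      from homogeneous_split_insert[OF sym' P4_free_complement[OF assms(3,4) insert.prems(2)[unfolded W]]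
          v ne this]
      show ?thesis unfolding W homogeneous_split_complement .
    qed
  qed
qed

section \<open>Twins, adjacent or not, and their existence\<close>

definition twins :: "('a \<Rightarrow> 'a \<Rightarrow> bool) \<Rightarrow> 'a set \<Rightarrow> 'a \<Rightarrow> 'a \<Rightarrow> bool" where
  "twins E W u v \<longleftrightarrow> u \<in> W \<and> v \<in> W \<and> u \<noteq> v \<and> (\<forall>w\<in>W - {u, v}. E u w \<longleftrightarrow> E v w)"

lemma twins_sym: "twins E W u v \<Longrightarrow> twins E W v u"
  unfolding twins_def by blast

text \<open>A vertex outside the part that contains \<open>u\<close> and \<open>v\<close> is
  adjacent to all of that part or to none of it, so it cannot distinguish them.\<close>

lemma twins_homogeneous_split:
  assumes "symp E" "homogeneous_split E W A B" "twins E A u v \<or> twins E B u v"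
  shows "twins E W u v"
  using assms(2,3) sympD[OF assms(1)] unfolding homogeneous_split_def twins_def
  by (elim conjE disjE) blast+

text \<open>Twins inside a part of a split remain twins in the whole graph. If neither part has two
  vertices, both are singletons and no third vertex is left to distinguish the two.\<close>

lemma P4_free_twins:
  assumes "finite W" "2 \<le> card W" "symp E" "irreflp E" "P4_free E W"
  shows "\<exists>u v. twins E W u v"
  using assms(1,2,5)
proof (induction W rule: finite_psubset_induct)
  case (psubset W)
  then obtain A B where AB: "homogeneous_split E W A B"
    using P4_free_homogeneous_split assms(3,4) by metis
  then have sub: "A \<subset> W" "B \<subset> W" "A \<union> B = W" "A \<noteq> {}" "B \<noteq> {}" "A \<inter> B = {}"
    unfolding homogeneous_split_def by auto
  have IH: "\<exists>u v. twins E W u v" if "C = A \<or> C = B" "2 \<le> card C" for C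
    using psubset.IH[of C] that sub P4_free_subset[OF psubset.prems(2), of C]
      twins_homogeneous_split[OF assms(3) AB] by blast
  show ?case
  proof (cases "2 \<le> card A \<or> 2 \<le> card B")
    case True
    then show ?thesis using IH by blast
  next
    case False
    have "finite A" "finite B" using sub psubset.hyps(1) finite_subset by auto
    then have "card A = 1" "card B = 1" using False sub card_gt_0_iff
      by (metis One_nat_def Suc_1 Suc_leI le_antisym not_less_eq_eq)+
    then obtain a b where "A = {a}" "B = {b}" by (auto simp: card_1_singleton_iff)
    then have "twins E W a b" using sub unfolding twins_def by auto
    then show ?thesis by blast
  qed
qed

section \<open>Eigenvectors as functions on a vertex set, so that deleting a vertex means shrinking
  the set\<close>

definition eigenfunction :: "('a \<Rightarrow> 'a \<Rightarrow> bool) \<Rightarrow> 'a set \<Rightarrow> 'c::field \<Rightarrow> ('a \<Rightarrow> 'c) \<Rightarrow> bool" where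
  "eigenfunction E W l x \<longleftrightarrow> (\<forall>v\<in>W. (\<Sum>u\<in>W. if E v u then x u else 0) = l * x v)"

text \<open>In the difference of the equations at \<open>u\<close> and \<open>v\<close> all terms
  outside \<open>{u, v}\<close> cancel. What remains is \<open>l * (x u - x v) = 0\<close> for
  non-adjacent twins and \<open>(l + 1) * (x u - x v) = 0\<close> for adjacent ones.\<close>

lemma eigenfunction_twins:
  assumes "finite W" "symp E" "irreflp E" "eigenfunction E W l x" "twins E W u v"
    and "l \<noteq> 0" "l \<noteq> - 1"
  shows "x u = x v"
proof -
  let ?f = "\<lambda>u w. if E u w then x w else 0"
  have uv: "u \<in> W" "v \<in> W" "u \<noteq> v" "\<And>w. w \<in> W - {u, v} \<Longrightarrow> E u w \<longleftrightarrow> E v w"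
    using assms(5) unfolding twins_def by auto
  have split: "sum f W = sum f (W - {u, v}) + (f u + f v)" for f :: "'a \<Rightarrow> 'b"
    using sum.subset_diff[of "{u, v}" W f] assms(1) uv(1-3) by simp
  have E: "\<not> E u u" "\<not> E v v" "E v u \<longleftrightarrow> E u v"
    using assms(2,3) by (blast dest: sympD irreflpD)+
  have "sum (?f u) (W - {u, v}) = sum (?f v) (W - {u, v})"
    by (rule sum.cong) (auto simp: uv(4))
  moreover have "l * x u = sum (?f u) W" "l * x v = sum (?f v) W"
    using assms(4) uv(1,2) unfolding eigenfunction_def by auto
  ultimately have "l * x u - l * x v = ?f u u + ?f u v - (?f v u + ?f v v)"
    by (simp only: split[of "?f u"] split[of "?f v"] add_diff_cancel_left)
  then have "l * x u - l * x v = (if E u v then x v - x u else 0)" using E by simp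
  then have "l * (x u - x v) = 0 \<or> (l + 1) * (x u - x v) = 0"
    by (auto simp: algebra_simps split: if_splits)
  then show ?thesis using assms(6,7) by (auto simp: eq_neg_iff_add_eq_0)
qed

lemma eigenfunction_eq_0:
  assumes "finite W" "symp E" "irreflp E" "P4_free E W" "eigenfunction E W l x"
    and "l \<noteq> 0" "l \<noteq> - 1" and "\<And>u v. twins E W u v \<Longrightarrow> x u = 0"
  shows "\<forall>v\<in>W. x v = 0"
  using assms(1,4,5,8)
proof (induction W rule: finite_psubset_induct)
  case (psubset W)
  show ?case
  proof (cases "2 \<le> card W")
    case False
    then consider "W = {}" | v where "W = {v}"
      using psubset.hyps(1)
      by (metis One_nat_def card_0_eq card_1_singletonE le_SucE le_zero_eq nat_le_linear
          numeral_2_eq_2)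
    then show ?thesis
    proof cases
      case 2
      have "\<not> E v v" using assms(3) by (rule irreflpD)
      with 2 psubset.prems(2) assms(6) show ?thesis
        unfolding eigenfunction_def by simp
    qed simp
  next
    case True
    then obtain u v where uv: "twins E W u v"
      using P4_free_twins psubset.hyps(1) psubset.prems(1) assms(2,3) by blast
    then have W: "u \<in> W" "v \<in> W" "u \<noteq> v" unfolding twins_def by auto
    have x0: "x u = 0" "x v = 0" using psubset.prems(3) uv twins_sym by metis+
    let ?W = "W - {v}"
    \<comment> \<open>Since \<open>x v = 0\<close>, dropping \<open>v\<close> changes none of the
      neighbor sums.\<close>
    have eig: "eigenfunction E ?W l x"
      using psubset.prems(2) x0 W psubset.hyps(1) unfolding eigenfunction_def
      by (auto simp: sum_diff1)
    have "x a = 0" if ab: "twins E ?W a b" for a b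
    \<comment> \<open>A pair containing \<open>u\<close> may be new. Its two values still agree by
      \<open>eigenfunction_twins\<close> in the smaller graph, and the value at \<open>u\<close> is
      0.\<close>
    proof (cases "a = u \<or> b = u")
      case True
      then show ?thesis
        using eigenfunction_twins[OF _ assms(2,3) eig ab assms(6,7)] psubset.hyps(1) x0 by auto
    next
      case False
      \<comment> \<open>The deleted vertex separates no pair that its twin does not separate.\<close>
      have "E v a \<longleftrightarrow> E u a" "E v b \<longleftrightarrow> E u b"
        using uv ab False unfolding twins_def by auto
      moreover have "E a u \<longleftrightarrow> E b u" using ab False W unfolding twins_def by auto
      ultimately have "E a v \<longleftrightarrow> E b v" using sympD[OF assms(2)] by metis
      then have "twins E W a b" using ab unfolding twins_def by blast
      then show ?thesis by (rule psubset.prems(3))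
    qed
    then have "\<forall>v\<in>?W. x v = 0"
      using psubset.IH[of ?W] eig W P4_free_subset[OF psubset.prems(1)] by blast
    then show ?thesis using x0 by auto
  qed
qed

section \<open>Linear algebra: underdetermined systems and kernels of Hermitian matrices\<close>

lemma homogeneous_system_nontrivial_solution:
  fixes f :: "'b \<Rightarrow> 'r \<Rightarrow> 'c::field"
  assumes "finite R" "finite B" "card R < card B"
  shows "\<exists>c. (\<exists>b\<in>B. c b \<noteq> 0) \<and> (\<forall>r\<in>R. (\<Sum>b\<in>B. c b * f b r) = 0)"
  using assms
proof (induction R arbitrary: B f rule: finite_induct)
  case empty
  then have "B \<noteq> {}" by auto
  then show ?case by (intro exI[of _ "\<lambda>_. 1"]) auto
next
  case (insert r R)
  show ?case
  proof (cases "\<forall>b\<in>B. f b r = 0")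
    case True
    have "card R < card B" using insert by simp
    from insert.IH[OF insert.prems(1) this, of f] obtain c
      where "\<exists>b\<in>B. c b \<noteq> 0" "\<forall>r\<in>R. (\<Sum>b\<in>B. c b * f b r) = 0" by blast
    with True show ?thesis by (intro exI[of _ c]) simp
  next
    case False
    then obtain p where p: "p \<in> B" "f p r \<noteq> 0" by blast
    let ?B = "B - {p}"
    have "card R < card ?B" "finite ?B" using insert p by auto
    \<comment> \<open>Gaussian elimination: solving equation \<open>r\<close> for the unknown at the
      pivot \<open>p\<close> leaves one equation and one unknown fewer. The value
      \<open>c' p\<close> below is the one that equation \<open>r\<close> dictates.\<close>
    from insert.IH[OF this(2,1), of "\<lambda>b s. f b s - f b r / f p r * f p s"] obtain c
      where c: "\<exists>b\<in>?B. c b \<noteq> 0"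
        "\<And>s. s \<in> R \<Longrightarrow> (\<Sum>b\<in>?B. c b * (f b s - f b r / f p r * f p s)) = 0" by blast
    define c' where "c' = c(p := - (\<Sum>b\<in>?B. c b * f b r) / f p r)"
    have sum: "(\<Sum>b\<in>B. c' b * f b s) =
        (\<Sum>b\<in>?B. c b * f b s) - (\<Sum>b\<in>?B. c b * f b r) / f p r * f p s" for s
    proof -
      have "(\<Sum>b\<in>B. c' b * f b s) = c' p * f p s + (\<Sum>b\<in>?B. c' b * f b s)"
        using insert.prems(1) p(1) by (rule sum.remove)
      also have "(\<Sum>b\<in>?B. c' b * f b s) = (\<Sum>b\<in>?B. c b * f b s)"
        by (rule sum.cong) (auto simp: c'_def)
      finally show ?thesis by (simp add: c'_def)
    qed
    have "(\<Sum>b\<in>B. c' b * f b s) = 0" if "s \<in> R" for s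
    proof -
      have "(\<Sum>b\<in>?B. c b * f b s) - (\<Sum>b\<in>?B. c b * f b r) / f p r * f p s =
          (\<Sum>b\<in>?B. c b * (f b s - f b r / f p r * f p s))"
        by (simp add: right_diff_distrib sum_subtractf sum_divide_distrib sum_distrib_right
            mult.assoc)
      then show ?thesis using sum c(2)[OF that] by simp
    qed
    moreover have "(\<Sum>b\<in>B. c' b * f b r) = 0" using sum p(2) by simp
    moreover have "\<exists>b\<in>B. c' b \<noteq> 0" using c(1) by (auto simp: c'_def)
    ultimately show ?thesis by blast
  qed
qed

text \<open>Moving \<open>M\<close> across the inner product turns the squared norm of
  \<open>M v\<close> into the product of \<open>v\<close> with \<open>M (M v)\<close>, which is
  0.\<close>

lemma hermitian_mult_eq_0:
  fixes M :: "complex mat"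
  assumes M: "M \<in> carrier_mat n n" and v: "v \<in> carrier_vec n"
    and herm: "\<And>i j. i < n \<Longrightarrow> j < n \<Longrightarrow> M $$ (i, j) = cnj (M $$ (j, i))"
    and 0: "M *\<^sub>v (M *\<^sub>v v) = 0\<^sub>v n"
  shows "M *\<^sub>v v = 0\<^sub>v n"
proof -
  let ?w = "M *\<^sub>v v"
  have w: "?w \<in> carrier_vec n" using M v by simp
  have mult: "(M *\<^sub>v u) $ i = (\<Sum>j<n. M $$ (i, j) * u $ j)" if "u \<in> carrier_vec n" "i < n" for u i
    using M that by (auto simp: scalar_prod_def atLeast0LessThan)
  have "u \<bullet>c u = (\<Sum>i<n. u $ i * cnj (u $ i))" if "u \<in> carrier_vec n" for u :: "complex vec"
    using that by (simp add: scalar_prod_def atLeast0LessThan)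
  then have "?w \<bullet>c ?w = (\<Sum>i<n. ?w $ i * cnj (?w $ i))" using w .
  also have "\<dots> = (\<Sum>i<n. \<Sum>j<n. M $$ (i, j) * v $ j * cnj (?w $ i))"
    by (rule sum.cong) (simp_all only: mult[OF v] sum_distrib_right lessThan_iff)
  also have "\<dots> = (\<Sum>j<n. \<Sum>i<n. M $$ (i, j) * v $ j * cnj (?w $ i))"
    by (rule sum.swap)
  also have "\<dots> = (\<Sum>j<n. v $ j * cnj ((M *\<^sub>v ?w) $ j))"
  proof (rule sum.cong)
    fix j assume j: "j \<in> {..<n}"
    have "(\<Sum>i<n. M $$ (i, j) * v $ j * cnj (?w $ i)) =
        (\<Sum>i<n. v $ j * cnj (M $$ (j, i) * ?w $ i))"
    proof (rule sum.cong)
      fix i assume "i \<in> {..<n}"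
      with j have "M $$ (i, j) = cnj (M $$ (j, i))" by (intro herm) auto
      then show "M $$ (i, j) * v $ j * cnj (?w $ i) = v $ j * cnj (M $$ (j, i) * ?w $ i)"
        by (simp only: complex_cnj_mult ac_simps)
    qed simp
    also have "\<dots> = v $ j * cnj (\<Sum>i<n. M $$ (j, i) * ?w $ i)"
      by (simp only: sum_distrib_left cnj_sum)
    finally show "(\<Sum>i<n. M $$ (i, j) * v $ j * cnj (?w $ i)) = v $ j * cnj ((M *\<^sub>v ?w) $ j)"
      using j by (simp only: mult[OF w] lessThan_iff)
  qed simp
  also have "\<dots> = 0" unfolding 0 by simp
  finally show ?thesis using w by simp
qed

text \<open>Repeated use of \<open>hermitian_mult_eq_0\<close> strips one factor at a time. For a
  shifted matrix this says that generalized eigenvectors are already eigenvectors.\<close>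

lemma hermitian_mat_kernel_pow:
  fixes M :: "complex mat"
  assumes M: "M \<in> carrier_mat n n"
    and herm: "\<And>i j. i < n \<Longrightarrow> j < n \<Longrightarrow> M $$ (i, j) = cnj (M $$ (j, i))"
  shows "mat_kernel (M ^\<^sub>m Suc k) = mat_kernel M"
proof -
  have P: "M ^\<^sub>m k \<in> carrier_mat n n" for k using M by simp
  have zero: "X *\<^sub>v 0\<^sub>v n = 0\<^sub>v n" if "X \<in> carrier_mat n n" for X :: "complex mat"
    using that by (intro eq_vecI) auto
  have step: "M ^\<^sub>m Suc k *\<^sub>v v = M ^\<^sub>m k *\<^sub>v (M *\<^sub>v v)" if "v \<in> carrier_vec n" for k v
    using P[of k] M that by (simp add: assoc_mult_mat_vec[of _ n n _ n])
  have "M *\<^sub>v v = 0\<^sub>v n" if "v \<in> carrier_vec n" "M ^\<^sub>m Suc k *\<^sub>v v = 0\<^sub>v n" for v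
    using that
  proof (induction k arbitrary: v)
    case 0
    then show ?case using M by simp
  next
    case (Suc k)
    have "M *\<^sub>v (M *\<^sub>v v) = 0\<^sub>v n"
      using Suc.prems step[of v "Suc k"] M by (intro Suc.IH) auto
    from hermitian_mult_eq_0[OF M Suc.prems(1) _ this] herm show ?case by blast
  qed
  moreover have "M ^\<^sub>m Suc k *\<^sub>v v = 0\<^sub>v n" if "v \<in> carrier_vec n" "M *\<^sub>v v = 0\<^sub>v n" for v
    using zero[OF P] by (simp add: step[OF that(1)] that(2) del: pow_mat.simps)
  ultimately show ?thesis
    unfolding mat_kernel[OF P] mat_kernel[OF M] by blast
qed

section \<open>From digraphs to adjacency relations, and from twins to classes\<close>

lemma (in graph) symp_dominates: "symp (dominates G)"
  using sym_arcs unfolding symmetric_def by (blast intro: sympI dest: symD)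

lemma (in graph) irreflp_dominates: "irreflp (dominates G)"
  using adj_not_same by (blast intro: irreflpI)

lemma cograph_graph: "cograph G \<Longrightarrow> Digraph.graph G"
  unfolding cograph_def by blast

lemma (in graph) cograph_P4_free:
  assumes "cograph G"
  shows "P4_free (dominates G) (verts G)"
  unfolding P4_free_def
proof (intro notI, elim bexE conjE)
  fix a b c d
  assume abcd: "a \<in> verts G" "b \<in> verts G" "c \<in> verts G" "d \<in> verts G"
    and E: "a \<rightarrow>\<^bsub>G\<^esub> b" "b \<rightarrow>\<^bsub>G\<^esub> c" "c \<rightarrow>\<^bsub>G\<^esub> d"
    and nE: "\<not> a \<rightarrow>\<^bsub>G\<^esub> c" "\<not> a \<rightarrow>\<^bsub>G\<^esub> d" "\<not> b \<rightarrow>\<^bsub>G\<^esub> d"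
  have sym: "x \<rightarrow>\<^bsub>G\<^esub> y \<longleftrightarrow> y \<rightarrow>\<^bsub>G\<^esub> x" for x y
    using sympD[OF symp_dominates] by blast
  have loop: "\<not> x \<rightarrow>\<^bsub>G\<^esub> x" for x using irreflp_dominates by (rule irreflpD)
  \<comment> \<open>\<open>P4_free\<close> does not ask for distinct vertices; the adjacency pattern
    forces it. For instance, \<open>a = c\<close> would make \<open>d\<close> both a neighbor and a
    non-neighbor of the same vertex.\<close>
  have ne: "a \<noteq> b" "a \<noteq> c" "a \<noteq> d" "b \<noteq> c" "b \<noteq> d" "c \<noteq> d"
    using E nE sym loop by metis+
  define V where "V = {a, b, c, d}"
  define f :: "'a \<Rightarrow> nat" where
    "f = (\<lambda>v. if v = a then 0 else if v = b then 1 else if v = c then 2 else 3)"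
  have f: "f a = 0" "f b = 1" "f c = 2" "f d = 3" using ne by (simp_all add: f_def)
  have inj: "inj_on f V" unfolding inj_on_def V_def using f by simp
  have "{..<4} = {0, 1, 2, 3 :: nat}" by auto
  then have fV: "f ` V = {..<4}" by (simp add: V_def f)
  have adj: "x \<rightarrow>\<^bsub>G\<^esub> y \<longleftrightarrow> f y = Suc (f x) \<or> f x = Suc (f y)" if "x \<in> V" "y \<in> V" for x y
  proof -
    have "b \<rightarrow>\<^bsub>G\<^esub> a" "c \<rightarrow>\<^bsub>G\<^esub> b" "d \<rightarrow>\<^bsub>G\<^esub> c" "\<not> c \<rightarrow>\<^bsub>G\<^esub> a" "\<not> d \<rightarrow>\<^bsub>G\<^esub> a" "\<not> d \<rightarrow>\<^bsub>G\<^esub> b"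
      using E nE sym by metis+
    with that E nE loop f show ?thesis unfolding V_def by (elim insertE emptyE) simp_all
  qed
  define H where "H = G \<lparr> verts := V, arcs := {e \<in> arcs G. tail G e \<in> V \<and> head G e \<in> V} \<rparr>"
  have H: "verts H = V" "arcs H = {e \<in> arcs G. tail G e \<in> V \<and> head G e \<in> V}"
    "tail H = tail G" "head H = head G"
    by (simp_all add: H_def)
  have wfH: "wf_digraph H" by (rule wf_digraph.intro) (simp_all add: H)
  have "V \<subseteq> verts G" using abcd by (simp add: V_def)
  then have ind: "induced_subgraph H G"
    unfolding induced_subgraph_def subgraph_def compatible_def
    using wfH wf_digraph by (simp add: H)
  \<comment> \<open>The arcs of \<open>path_graph\<close> are pairs of numbers, so each arc goes to
    the numbers of its tail and head, and the new projections are \<open>fst\<close> and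
    \<open>snd\<close>. Injectivity on arcs rests on the absence of parallel arcs.\<close>
  define h where "h = \<lparr> iso_verts = f, iso_arcs = (\<lambda>e. (f (tail G e), f (head G e))),
    iso_head = snd, iso_tail = fst \<rparr>"
  have "inj_on (iso_arcs h) (arcs H)"
  proof (rule inj_onI)
    fix e1 e2 assume e: "e1 \<in> arcs H" "e2 \<in> arcs H" "iso_arcs h e1 = iso_arcs h e2"
    then have "tail G e1 = tail G e2" "head G e1 = head G e2"
      using inj_onD[OF inj] by (simp_all add: H h_def)
    with e show "e1 = e2" by (intro no_multi_arcs) (simp_all add: H arc_to_ends_def)
  qed
  then have iso: "pre_digraph.digraph_isomorphism H h"
    unfolding pre_digraph.digraph_isomorphism_def using wfH inj by (simp add: H h_def)
  have "(\<lambda>e. (f (tail G e), f (head G e))) ` arcs H =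
      {(f x, f y) | x y. x \<in> V \<and> y \<in> V \<and> x \<rightarrow>\<^bsub>G\<^esub> y}"
    unfolding H arcs_ends_conv by blast
  also have "\<dots> = {(i, j). i \<in> f ` V \<and> j \<in> f ` V \<and> (j = Suc i \<or> i = Suc j)}"
    using adj by blast
  also have "\<dots> = parcs (path_graph 4)" unfolding fV path_graph_def by simp
  finally have "app_iso h H = with_proj (path_graph 4)"
    using fV by (simp add: app_iso_def h_def H(1) with_proj_def path_graph_def)
  with iso ind assms show False unfolding cograph_def digraph_iso_def by metis
qed

text \<open>The fiber of \<open>N\<close> through \<open>u\<close> is maximal because every larger
  set \<open>T\<close> contains \<open>u\<close>, so all its members have the neighborhood of
  \<open>u\<close>. With \<open>N\<close> as a parameter this covers both kinds of classes.\<close>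

lemma nbhd_equal_class:
  assumes fin: "finite (verts G)" and uv: "u \<in> verts G" "v \<in> verts G" "u \<noteq> v" "N u = N v"
  defines "S \<equiv> {w \<in> verts G. N w = N u}"
  shows "nbhd_equal_set N G S" "nbhd_equal_set N G T \<Longrightarrow> S \<subseteq> T \<Longrightarrow> T = S"
proof -
  have "card {u, v} \<le> card S" using fin uv by (intro card_mono) (auto simp: S_def)
  then show "nbhd_equal_set N G S" using uv(3) unfolding nbhd_equal_set_def by (auto simp: S_def)
  show "T = S" if T: "nbhd_equal_set N G T" "S \<subseteq> T"
  proof
    have "u \<in> T" using T(2) uv(1) by (auto simp: S_def)
    then show "T \<subseteq> S" using T(1) unfolding nbhd_equal_set_def S_def by blast
  qed (rule T(2))
qed

text \<open>Adjacent twins have equal closed neighborhoods, non-adjacent twins equal open ones.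
  Either way the fiber of the neighborhood map through \<open>u\<close> is the class sought.\<close>

lemma (in graph) twins_in_class:
  assumes "twins (dominates G) (verts G) u v"
  shows "\<exists>S. (duplication_class G S \<or> coduplication_class G S) \<and> u \<in> S"
proof -
  have sym: "x \<rightarrow>\<^bsub>G\<^esub> y \<Longrightarrow> y \<rightarrow>\<^bsub>G\<^esub> x" for x y
    using symp_dominates by (rule sympD)
  have loop: "\<not> x \<rightarrow>\<^bsub>G\<^esub> x" for x using irreflp_dominates by (rule irreflpD)
  have uv: "u \<in> verts G" "v \<in> verts G" "u \<noteq> v"
    and tw: "w \<in> verts G \<Longrightarrow> w \<noteq> u \<Longrightarrow> w \<noteq> v \<Longrightarrow> u \<rightarrow>\<^bsub>G\<^esub> w \<longleftrightarrow> v \<rightarrow>\<^bsub>G\<^esub> w" for w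
    using assms unfolding twins_def by auto
  show ?thesis
  proof (cases "u \<rightarrow>\<^bsub>G\<^esub> v")
    case True
    then have "closed_nbhd G u = closed_nbhd G v"
      using uv tw sym unfolding closed_nbhd_def open_nbhd_def by blast
    from nbhd_equal_class[OF finite_verts uv, of "closed_nbhd G", OF this] uv(1) show ?thesis
      unfolding coduplication_class_def by blast
  next
    case False
    have "open_nbhd G u = open_nbhd G v"
    proof -
      have "u \<rightarrow>\<^bsub>G\<^esub> w \<longleftrightarrow> v \<rightarrow>\<^bsub>G\<^esub> w" if "w \<in> verts G" for w
        using tw[OF that] False sym loop by metis
      then show ?thesis unfolding open_nbhd_def by blast
    qed
    from nbhd_equal_class[OF finite_verts uv, of "open_nbhd G", OF this] uv(1) show ?thesis
      unfolding duplication_class_def by blast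
  qed
qed

lemma class_twins:
  assumes "duplication_class G S \<or> coduplication_class G S" "u \<in> S" "v \<in> S" "u \<noteq> v"
  shows "twins (dominates G) (verts G) u v"
proof -
  have S: "S \<subseteq> verts G" "open_nbhd G u = open_nbhd G v \<or> closed_nbhd G u = closed_nbhd G v"
    using assms unfolding duplication_class_def coduplication_class_def nbhd_equal_set_def by blast+
  have "u \<rightarrow>\<^bsub>G\<^esub> w \<longleftrightarrow> v \<rightarrow>\<^bsub>G\<^esub> w" if w: "w \<in> verts G" "w \<noteq> u" "w \<noteq> v" for w
  proof -
    have "w \<in> open_nbhd G u \<longleftrightarrow> w \<in> open_nbhd G v"
      using S(2) w unfolding closed_nbhd_def by auto
    then show ?thesis using w(1) unfolding open_nbhd_def by simp
  qed
  then show ?thesis using S(1) assms(2-4) unfolding twins_def by auto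
qed

section \<open>Multiplicity as a kernel dimension, and its bound by the number of classes\<close>

lemma (in kernel) kernel_dim_le_card:
  assumes R: "R \<subseteq> {..<nc}"
    and inj: "\<And>v. v \<in> mat_kernel A \<Longrightarrow> (\<And>i. i \<in> R \<Longrightarrow> v $ i = 0) \<Longrightarrow> v = 0\<^sub>v nc"
  shows "kernel_dim A \<le> card R"
proof (rule ccontr)
  assume less: "\<not> ?thesis"
  obtain B where B: "finite B" "basis B" using kernel_basis_exists[OF A] by blast
  then have card: "card B = kernel_dim A" using Ker.dim_basis by simp
  have sub: "B \<subseteq> mat_kernel A" and ind: "lin_indpt B"
    using B(2) unfolding Ker.basis_def by auto
  have "finite R" using R finite_subset by blast
  \<comment> \<open>With more basis vectors than coordinates in \<open>R\<close>, some nontrivial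
    combination of the basis vanishes on \<open>R\<close>. By \<open>inj\<close> it is the zero
    vector, against linear independence.\<close>
  from homogeneous_system_nontrivial_solution[OF this B(1), of "\<lambda>b i. b $ i"] less card
  obtain c where c: "\<exists>b\<in>B. c b \<noteq> 0" "\<forall>i\<in>R. (\<Sum>b\<in>B. c b * b $ i) = 0" by auto
  have "lincomb c B \<in> mat_kernel A" using Ker.lincomb_closed[OF sub, of c] by simp
  moreover have "lincomb c B $ i = 0" if "i \<in> R" for i
    using that R c(2) lincomb_index[OF _ sub] by auto
  ultimately have "lincomb c B = 0\<^sub>v nc" by (rule inj)
  then have "lin_dep B" unfolding Ker.lin_dep_def using B(1) c(1) by auto
  with ind show False by simp
qed

interpretation of_real_poly: map_poly_inj_idom_divide_hom complex_of_real ..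

lemma order_char_poly_symmetric:
  fixes A :: "real mat"
  assumes A: "A \<in> carrier_mat n n"
    and sym: "\<And>i j. i < n \<Longrightarrow> j < n \<Longrightarrow> A $$ (i, j) = A $$ (j, i)"
  shows "Polynomial.order ev (char_poly A) =
    kernel_dim (char_matrix (map_mat complex_of_real A) (complex_of_real ev))"
proof -
  let ?A = "map_mat complex_of_real A" and ?ev = "complex_of_real ev"
  let ?M = "char_matrix ?A ?ev"
  have A': "?A \<in> carrier_mat n n" using A by simp
  then have M: "?M \<in> carrier_mat n n" by simp
  have herm: "?M $$ (i, j) = cnj (?M $$ (j, i))" if "i < n" "j < n" for i j
    using A that sym[OF that] by (simp add: char_matrix_def)
  have ker: "mat_kernel (?M ^\<^sub>m Suc k) = mat_kernel ?M" for k
    using hermitian_mat_kernel_pow[OF M] herm by blast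
  obtain as where "char_poly ?A = (\<Prod>a\<leftarrow>as. [:- a, 1:])"
    using char_poly_factorized[OF A'] by blast
  then obtain n_as where jnf: "jordan_nf ?A n_as" using jordan_nf_exists[OF A'] by blast
  \<comment> \<open>The sum of all block sizes bounds each of them, so every
    \<open>min (Suc k) m\<close> below equals \<open>m\<close>. The successor makes the exponent
    positive, as \<open>hermitian_mat_kernel_pow\<close> requires.\<close>
  define k where "k = sum_list (map fst n_as)"
  have k: "m \<le> k" if "(m, e) \<in> set n_as" for m e
    unfolding k_def using that by (intro member_le_sum_list) force+
  have "Polynomial.order ev (char_poly A) = Polynomial.order ?ev (char_poly ?A)"
    unfolding of_real_hom.char_poly_hom[OF A] of_real_poly.order_hom ..
  also have "\<dots> = sum_list (map fst (filter (\<lambda>na. snd na = ?ev) n_as))"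
    by (rule jordan_nf_order[OF jnf])
  also have "\<dots> = (\<Sum>m\<leftarrow>map fst [(m, e)\<leftarrow>n_as. e = ?ev]. min (Suc k) m)"
  proof -
    have "map (min (Suc k)) (map fst [(m, e)\<leftarrow>n_as. e = ?ev]) = map fst [(m, e)\<leftarrow>n_as. e = ?ev]"
      by (rule map_idI) (auto dest: k)
    then show ?thesis by (simp only: case_prod_beta')
  qed
  also have "\<dots> = dim_gen_eigenspace ?A ?ev (Suc k)"
    by (rule dim_gen_eigenspace[OF jnf, symmetric])
  also have "\<dots> = kernel_dim ?M"
    unfolding dim_gen_eigenspace_def kernel_dim_def ker
    using M by simp
  finally show ?thesis .
qed

text \<open>Row \<open>i\<close> of the kernel equation is the eigenvalue equation at
  \<open>vs ! i\<close>. As \<open>vs\<close> has no repetition, the sum over positions is a sum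
  over vertices.\<close>

lemma eigenfunction_of_mat_kernel:
  fixes ev :: real and G :: "('a, 'b) pre_digraph"
  assumes "distinct vs"
    and v: "v \<in> mat_kernel (char_matrix (map_mat complex_of_real (adjacency_matrix G vs)) (of_real ev))"
    and x: "\<And>i. i < length vs \<Longrightarrow> x (vs ! i) = v $ i"
  shows "eigenfunction (dominates G) (set vs) (complex_of_real ev) x"
  unfolding eigenfunction_def
proof
  let ?n = "length vs"
  let ?A = "map_mat complex_of_real (adjacency_matrix G vs)"
  have A: "?A \<in> carrier_mat ?n ?n" by (simp add: adjacency_matrix_def)
  have M: "char_matrix ?A (of_real ev) \<in> carrier_mat ?n ?n" by (rule char_matrix_closed[OF A])
  have vc: "v \<in> carrier_vec ?n" using mat_kernelD(1)[OF M v] .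
  have bij: "bij_betw ((!) vs) {..<?n} (set vs)"
    using assms(1) by (rule bij_betw_nth) auto
  fix a assume "a \<in> set vs"
  then obtain i where i: "i < ?n" "a = vs ! i" by (auto simp: in_set_conv_nth)
  let ?c = "\<lambda>j. if vs ! i \<rightarrow>\<^bsub>G\<^esub> vs ! j then 1 else 0 :: complex"
  have "0 = (char_matrix ?A (of_real ev) *\<^sub>v v) $ i"
    using mat_kernelD(2)[OF M v] i(1) by simp
  also have "\<dots> = (\<Sum>j<?n. char_matrix ?A (of_real ev) $$ (i, j) * v $ j)"
    using M vc i(1) by (auto simp: scalar_prod_def atLeast0LessThan)
  also have "\<dots> = (\<Sum>j<?n. ?c j * v $ j - (if i = j then of_real ev * v $ j else 0))"
    using i(1) by (intro sum.cong) (auto simp: char_matrix_def adjacency_matrix_def algebra_simps)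
  also have "\<dots> = (\<Sum>j<?n. ?c j * v $ j) - of_real ev * v $ i"
    using i(1) by (simp add: sum_subtractf sum.delta')
  finally have "(\<Sum>j<?n. ?c j * v $ j) = of_real ev * x a" using i x by simp
  moreover have "(\<Sum>u\<in>set vs. if a \<rightarrow>\<^bsub>G\<^esub> u then x u else 0) = (\<Sum>j<?n. ?c j * v $ j)"
    unfolding sum.reindex_bij_betw[OF bij, symmetric] using i x by (intro sum.cong) auto
  ultimately show "(\<Sum>u\<in>set vs. if a \<rightarrow>\<^bsub>G\<^esub> u then x u else 0) = of_real ev * x a" by simp
qed

lemma kernel_dim_adjacency_le_card_classes:
  fixes G :: "('a, 'b) pre_digraph" and ev :: real
  assumes "cograph G" and "distinct vs" and "set vs = verts G" and "ev \<noteq> 0" and "ev \<noteq> - 1"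
  shows "kernel_dim (char_matrix (map_mat complex_of_real (adjacency_matrix G vs)) (complex_of_real ev))
    \<le> card {S. duplication_class G S} + card {S. coduplication_class G S}"
proof -
  note graph = cograph_graph[OF assms(1)]
  note sym = graph.symp_dominates[OF graph] and irr = graph.irreflp_dominates[OF graph]
  have fin: "finite (verts G)" unfolding assms(3)[symmetric] by simp
  let ?n = "length vs"
  let ?M = "char_matrix (map_mat complex_of_real (adjacency_matrix G vs)) (complex_of_real ev)"
  have M: "?M \<in> carrier_mat ?n ?n" by (intro char_matrix_closed) (simp add: adjacency_matrix_def)
  define C where "C = {S. duplication_class G S} \<union> {S. coduplication_class G S}"
  have C_sub: "S \<subseteq> verts G" "S \<noteq> {}" if "S \<in> C" for S
    using that unfolding C_def duplication_class_def coduplication_class_def nbhd_equal_set_def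
    by auto
  then have "finite C" using fin by (intro finite_subset[of C "Pow (verts G)"]) auto
  define idx where "idx = the_inv_into {..<?n} ((!) vs)"
  have bij: "bij_betw ((!) vs) {..<?n} (verts G)"
    using assms(2,3) by (intro bij_betw_nth) auto
  have idx: "idx (vs ! i) = i" if "i < ?n" for i
    unfolding idx_def using bij that by (intro the_inv_into_f_f) (auto simp: bij_betw_def)
  define rep where "rep S = (SOME v. v \<in> S)" for S :: "'a set"
  have rep: "rep S \<in> S" if "S \<in> C" for S
    unfolding rep_def using C_sub(2)[OF that] by (simp add: some_in_eq)
  \<comment> \<open>The matrix positions of one chosen representative per class.\<close>
  let ?R = "(\<lambda>S. idx (rep S)) ` C"
  have "kernel_dim ?M \<le> card ?R"
  proof (rule kernel.kernel_dim_le_card[OF kernel.intro[OF M]])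
    show "?R \<subseteq> {..<?n}"
    proof safe
      fix S assume "S \<in> C"
      then have "rep S \<in> set vs" using rep C_sub(1) assms(3) by blast
      then show "idx (rep S) < ?n" by (metis idx in_set_conv_nth)
    qed
    fix v assume v: "v \<in> mat_kernel ?M" and 0: "\<And>i. i \<in> ?R \<Longrightarrow> v $ i = 0"
    let ?x = "\<lambda>a. v $ idx a"
    have eig: "eigenfunction (dominates G) (verts G) (complex_of_real ev) ?x"
      using eigenfunction_of_mat_kernel[OF assms(2) v, of ?x] idx assms(3) by simp
    have ev: "complex_of_real ev \<noteq> 0" "complex_of_real ev \<noteq> - 1"
      using assms(4,5) by (simp, metis of_real_1 of_real_eq_iff of_real_minus)
    have "?x a = 0" if tw: "twins (dominates G) (verts G) a b" for a b
    proof -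
      obtain S where S: "S \<in> C" "a \<in> S"
        using graph.twins_in_class[OF graph tw] unfolding C_def by blast
      \<comment> \<open>Any two members of a class are twins, so the eigenfunction is constant on
        it, and its value at the representative is 0 by assumption.\<close>
      have "?x a = ?x (rep S)"
      proof (cases "a = rep S")
        case False
        then have "twins (dominates G) (verts G) a (rep S)"
          using S rep[OF S(1)] class_twins[of G S a "rep S"] unfolding C_def by blast
        from eigenfunction_twins[OF fin sym irr eig this ev] show ?thesis .
      qed simp
      with 0 S(1) show ?thesis by simp
    qed
    with eigenfunction_eq_0[OF fin sym irr graph.cograph_P4_free[OF graph assms(1)] eig ev]
    have zero: "\<forall>a\<in>verts G. ?x a = 0" by blast
    show "v = 0\<^sub>v ?n"
    proof (rule eq_vecI)
      fix i assume "i < dim_vec (0\<^sub>v ?n :: complex vec)"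
      then have i: "i < ?n" by simp
      then have "?x (vs ! i) = 0" using zero assms(3) nth_mem by blast
      with i show "v $ i = 0\<^sub>v ?n $ i" using idx by simp
    qed (use mat_kernelD(1)[OF M v] in simp)
  qed
  also have "\<dots> \<le> card C" using \<open>finite C\<close> by (rule card_image_le)
  also have "\<dots> \<le> card {S. duplication_class G S} + card {S. coduplication_class G S}"
    unfolding C_def by (rule card_Un_le)
  finally show ?thesis .
qed

theorem theorem4p5:
  fixes G :: "('a, 'b) pre_digraph" and vs :: "'a list" and ev :: real
  assumes "cograph G"
    and "distinct vs" and "set vs = verts G"
    and "eigenvalue (adjacency_matrix G vs) ev"
    and "ev \<noteq> 0" and "ev \<noteq> - 1"
  shows "Polynomial.order ev (char_poly (adjacency_matrix G vs))
           \<le> card {S. duplication_class G S} + card {S. coduplication_class G S}"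
proof -
  have "u \<rightarrow>\<^bsub>G\<^esub> v \<longleftrightarrow> v \<rightarrow>\<^bsub>G\<^esub> u" for u v
    using sympD[OF graph.symp_dominates[OF cograph_graph[OF assms(1)]]] by blast
  then have "Polynomial.order ev (char_poly (adjacency_matrix G vs)) =
      kernel_dim (char_matrix (map_mat complex_of_real (adjacency_matrix G vs)) (complex_of_real ev))"
    by (intro order_char_poly_symmetric[where n = "length vs"]) (simp_all add: adjacency_matrix_def)
  also have "\<dots> \<le> card {S. duplication_class G S} + card {S. coduplication_class G S}"
    by (rule kernel_dim_adjacency_le_card_classes[OF assms(1-3,5,6)])
  finally show ?thesis .
qed

end
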